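(* Let $n\ge r\ge 1$ be integers and $q$ a prime power, and set $\delta_q:=3$ if $q$ is odd and $q\ge5$, $\delta_q:=1$ if $q$ is even, and $\delta_q:=5/3$ if $q=3$. Then there exists a Kakeya set $K\subseteq\mathbb{F}_q^n$ of rank $r$ such that $$|K|\le\left(1-\frac{q-\delta_q}{2q^r}\right)^{\lfloor n/(r+1)\rfloor}q^n.$$
   Context: $\mathbb{F}_q$ denotes the finite field with $q$ elements. For a finite vector space $V$ and an integer $0\le r\le\dim V$, a subset $K\subseteq V$ is a Kakeya set of rank $r$ if for every subspace $L\le V$ with $\dim L=r$ there exists $v\in V$ such that $v+L\subseteq K$. *)

theory Defs
  imports "HOL-Analysis.Cartesian_Space"
begin

definition kakeya_set :: "nat \<Rightarrow> ('a::field ^ 'n) set \<Rightarrow> bool" where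
  "kakeya_set r K \<longleftrightarrow>
    (\<forall>L. vec.subspace L \<and> vec.dim L = r \<longrightarrow> (\<exists>v. (\<lambda>x. v + x) ` L \<subseteq> K))"

(* Meaningful only when q is a prime power. *)
definition kakeya_delta :: "nat \<Rightarrow> real" where
  "kakeya_delta q = (if even q then 1 else if q = 3 then 5 / 3 else 3)"

end

(* A set K of vectors of length r + 1 contains a translate of every hyperplane as soon as each
   linear functional has a level set disjoint from the complement of K, and such a complement may be
   placed inside a coordinate plane. In the plane, remove the points that lie neither on x = 0 nor on
   a line y = m x + m^2: these lines cover every direction, and since m and -x - m give the same
   value of m x + m^2, at most (q + 1) / 2 points of each other vertical line are covered.
   For general n take a product of n div (r + 1) such sets and a full coordinate space: an
   r-dimensional subspace projects to a proper subspace in every factor. *)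
theory Submission
  imports Defs "HOL-Library.FuncSet"
begin

section \<open>Points of the plane off the chosen family of lines\<close>

definition uncovered :: "('a::field \<times> 'a) set" where
  "uncovered = {(x, y). x \<noteq> 0 \<and> (\<forall>m. y \<noteq> m * x + m\<^sup>2)}"

text \<open>For \<open>b \<noteq> 0\<close> the line with slope \<open>m = - (a / b)\<close> in the
  family is the level \<open>b * m^2\<close> of the functional. For \<open>b = 0\<close>,
  \<open>a \<noteq> 0\<close> the level 0 is the line \<open>x = 0\<close>. The zero functional
  misses 1, an empty level.\<close>

lemma uncovered_misses_level:
  fixes a b :: "'a::field"
  obtains t where "\<And>x y. (x, y) \<in> uncovered \<Longrightarrow> a * x + b * y \<noteq> t"
proof (cases "b = 0")
  case True
  show ?thesis
  proof (cases "a = 0")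
    case True
    then show ?thesis using \<open>b = 0\<close> by (intro that[of 1]) auto
  next
    case False
    then show ?thesis using \<open>b = 0\<close> by (intro that[of 0]) (auto simp: uncovered_def)
  qed
next
  case False
  show ?thesis
  proof (rule that[of "b * (a / b)\<^sup>2"])
    fix x y :: 'a assume xy: "(x, y) \<in> uncovered"
    show "a * x + b * y \<noteq> b * (a / b)\<^sup>2"
    proof
      assume "a * x + b * y = b * (a / b)\<^sup>2"
      then have "b * y = b * ((- (a / b)) * x + (- (a / b))\<^sup>2)"
        using False by (simp add: algebra_simps)
      then have "y = (- (a / b)) * x + (- (a / b))\<^sup>2"
        using False by (metis mult_left_cancel)
      then show False using xy unfolding uncovered_def by blast
    qed
  qed
qed

text \<open>One representative \<open>g y\<close> per value and the images \<open>s (g y)\<close>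
  form two sets of size \<open>card (range f)\<close>. A common point has a single value under
  \<open>f\<close>, hence is a fixed point of \<open>s\<close>, so the two sets share at most one
  point.\<close>

lemma card_range_involution_invariant:
  fixes f :: "'a::finite \<Rightarrow> 'b"
  assumes inv: "\<And>m. f (s m) = f m" and fix1: "\<And>m m'. s m = m \<Longrightarrow> s m' = m' \<Longrightarrow> m = m'"
  shows "2 * card (range f) \<le> CARD('a) + 1"
proof -
  define g where "g = inv_into UNIV f"
  have fg: "f (g y) = y" if "y \<in> range f" for y
    using that unfolding g_def by (rule f_inv_into_f)
  have fsg: "f (s (g y)) = y" if "y \<in> range f" for y
    using fg[OF that] inv by simp
  have cg: "card (g ` range f) = card (range f)"
    by (intro card_image inj_on_inverseI[where g = f] fg)
  have ch: "card ((\<lambda>y. s (g y)) ` range f) = card (range f)"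
    by (intro card_image inj_on_inverseI[where g = f] fsg)
  let ?A = "g ` range f" and ?B = "(\<lambda>y. s (g y)) ` range f"
  have "s z = z" if z: "z \<in> ?A" "z \<in> ?B" for z
  proof -
    obtain y where y: "z = g y" "y \<in> range f" using z(1) by (rule imageE)
    obtain y' where y': "z = s (g y')" "y' \<in> range f" using z(2) by (rule imageE)
    have "y = y'" using fg[OF y(2)] fsg[OF y'(2)] y(1) y'(1) by simp
    then show ?thesis using y(1) y'(1) by simp
  qed
  then have "card (?A \<inter> ?B) \<le> 1"
    by (auto simp: card_le_Suc0_iff_eq intro: fix1)
  moreover have "card ?A + card ?B = card (?A \<union> ?B) + card (?A \<inter> ?B)"
    by (rule card_Un_Int) auto
  moreover have "card (?A \<union> ?B) \<le> CARD('a)"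
    by (rule card_mono) auto
  ultimately show ?thesis using cg ch by linarith
qed

text \<open>Over each \<open>x \<noteq> 0\<close> at most \<open>(q + 1) div 2\<close> of the
  \<open>q\<close> values of \<open>y\<close> are covered, which leaves at least
  \<open>q div 2\<close>.\<close>

lemma card_uncovered_ge:
  "(CARD('a) - 1) * (CARD('a) div 2) \<le> card (uncovered :: ('a::{field,finite} \<times> 'a) set)"
proof -
  have fib: "CARD('a) div 2 \<le> card (- range (\<lambda>m. m * x + m\<^sup>2))" if "x \<noteq> 0" for x :: 'a
  proof -
    have "2 * card (range (\<lambda>m. m * x + m\<^sup>2)) \<le> CARD('a) + 1"
    proof (rule card_range_involution_invariant[where s = "\<lambda>m. - x - m"])
      show "(- x - m) * x + (- x - m)\<^sup>2 = m * x + m\<^sup>2" for m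
        by (simp add: algebra_simps power2_eq_square)
      fix m m' assume *: "- x - m = m" "- x - m' = m'"
      then have x: "2 * m = - x" "2 * m' = - x"
        by (metis diff_add_cancel mult_2)+
      \<comment> \<open>A fixed point solves \<open>2 * m = - x\<close> with
        \<open>x \<noteq> 0\<close>: there is none in characteristic 2, and otherwise exactly
        one.\<close>
      then have "(2::'a) \<noteq> 0" using that by auto
      with x show "m = m'" by (metis mult_left_cancel)
    qed
    then show ?thesis by (simp add: Compl_eq_Diff_UNIV card_Diff_subset)
  qed
  have "(CARD('a) - 1) * (CARD('a) div 2) = (\<Sum>x\<in>- {0::'a}. CARD('a) div 2)"
    by (simp add: Compl_eq_Diff_UNIV card_Diff_subset)
  also have "\<dots> \<le> (\<Sum>x\<in>- {0::'a}. card (- range (\<lambda>m. m * x + m\<^sup>2)))"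
    by (intro sum_mono fib) auto
  also have "\<dots> = card (SIGMA x:- {0::'a}. - range (\<lambda>m. m * x + m\<^sup>2))"
    by (rule card_SigmaI[symmetric]) auto
  also have "(SIGMA x:- {0::'a}. - range (\<lambda>m. m * x + m\<^sup>2)) = uncovered"
    unfolding uncovered_def by auto
  finally show ?thesis .
qed

text \<open>For even \<open>q\<close> the count is exactly \<open>q * (q - 1) / 2\<close>. For odd
  \<open>q\<close> it is \<open>(q - 1)^2 / 2\<close>, and the bound asks for a delta of at least
  \<open>2 - 1 / q\<close>: this is \<open>5 / 3\<close> at \<open>q = 3\<close>, while 3 is always
  enough.\<close>

lemma card_uncovered_ge_real:
  fixes q :: nat
  assumes "q = CARD('a::{field,finite})"
  shows "real q * (real q - kakeya_delta q) / 2 \<le> real (card (uncovered :: ('a \<times> 'a) set))"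
proof -
  have "q \<ge> 1" using assms by (simp add: Suc_leI)
  have "(q - 1) * (q div 2) \<le> card (uncovered :: ('a \<times> 'a) set)"
    using card_uncovered_ge assms by blast
  then have ge: "real ((q - 1) * (q div 2)) \<le> real (card (uncovered :: ('a \<times> 'a) set))"
    using of_nat_le_iff by blast
  have "real q * (real q - kakeya_delta q) / 2 \<le> real ((q - 1) * (q div 2))"
  proof (cases "even q")
    case True
    then obtain k where "q = 2 * k" by blast
    then show ?thesis using \<open>q \<ge> 1\<close> by (simp add: kakeya_delta_def of_nat_diff field_simps)
  next
    case False
    then obtain k where "q = 2 * k + 1" using oddE by blast
    then show ?thesis
      by (cases "q = 3") (auto simp: kakeya_delta_def of_nat_diff field_simps)
  qed
  then show ?thesis using ge by linarith
qed

section \<open>Functionals vanishing on a small subspace\<close>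

text \<open>Pigeonhole: there are more coefficient vectors on \<open>I\<close> than tuples of values
  on a basis of \<open>L\<close>, so two of them agree on the basis. Their difference is nonzero and
  vanishes on the span.\<close>

lemma exists_annihilating_functional:
  fixes L :: "('a::{field,finite} ^ 'n::finite) set" and e :: "'i \<Rightarrow> 'n"
  assumes L: "vec.subspace L" and I: "finite I" "vec.dim L < card I"
  obtains a where "\<exists>i\<in>I. a i \<noteq> 0" "\<And>x. x \<in> L \<Longrightarrow> (\<Sum>i\<in>I. a i * x $ e i) = 0"
proof -
  obtain B where B: "B \<subseteq> L" "L \<subseteq> vec.span B" "card B = vec.dim L"
    by (rule vec.basis_exists)
  define F where "F = (\<lambda>c. \<lambda>b\<in>B. \<Sum>i\<in>I. c i * b $ e i)"
  let ?D = "I \<rightarrow>\<^sub>E (UNIV :: 'a set)" and ?T = "B \<rightarrow>\<^sub>E (UNIV :: 'a set)"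
  have "1 < CARD('a)"
    using card_mono[of UNIV "{0, 1 :: 'a}"] by simp
  then have "card ?T < card ?D"
    using I B by (simp add: card_funcsetE power_strict_increasing)
  moreover have "card (F ` ?D) \<le> card ?T"
    by (rule card_mono) (auto simp: F_def intro: finite_PiE)
  ultimately have "\<not> inj_on F ?D" by (intro pigeonhole) simp
  then obtain c d where cd: "c \<in> ?D" "d \<in> ?D" "F c = F d" "c \<noteq> d" unfolding inj_on_def by blast
  define a where "a = (\<lambda>i. c i - d i)"
  show ?thesis
  proof (rule that[of a])
    show "\<exists>i\<in>I. a i \<noteq> 0" using PiE_ext[OF cd(1,2)] cd(4) unfolding a_def by force
    let ?N = "{x. (\<Sum>i\<in>I. a i * x $ e i) = 0}"
    have "vec.subspace ?N"
    proof (rule vec.subspaceI)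
      fix s x assume "x \<in> ?N"
      moreover have "(\<Sum>i\<in>I. a i * (s *s x) $ e i) = s * (\<Sum>i\<in>I. a i * x $ e i)"
        unfolding sum_distrib_left by (rule sum.cong) auto
      ultimately show "s *s x \<in> ?N" by simp
    qed (auto simp: distrib_left sum.distrib)
    moreover have "B \<subseteq> ?N"
    proof
      fix b assume "b \<in> B"
      then have "(\<Sum>i\<in>I. c i * b $ e i) = (\<Sum>i\<in>I. d i * b $ e i)"
        using fun_cong[OF cd(3), of b] by (simp add: F_def)
      then show "b \<in> ?N" by (simp add: a_def algebra_simps sum_subtractf)
    qed
    ultimately have "vec.span B \<subseteq> ?N" by (rule vec.span_minimal[rotated])
    then show "(\<Sum>i\<in>I. a i * x $ e i) = 0" if "x \<in> L" for x using that B by blast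
  qed
qed

section \<open>Blocks of \<open>r + 1\<close> coordinates\<close>

text \<open>Block vectors are functions on \<open>nat\<close>, so that the length
  \<open>r + 1\<close> can depend on the number \<open>r\<close>. For \<open>1 \<le> r\<close>
  membership depends only on the entries at indices up to \<open>r\<close>.\<close>

definition removed :: "nat \<Rightarrow> (nat \<Rightarrow> 'a::field) set" where
  "removed r = {u. (u 0, u 1) \<in> uncovered \<and> (\<forall>i\<in>{2..r}. u i = 0)}"

text \<open>On removed vectors only the terms with index 0 and 1 survive, so the planar lemma
  supplies \<open>t\<close>. The second conclusion excludes an empty level: it matters when
  \<open>a 0 = a 1 = 0\<close>, where a later nonzero coefficient still attains
  \<open>t\<close>.\<close>

lemma removed_misses_level:
  fixes a :: "nat \<Rightarrow> 'a::field"
  assumes "1 \<le> r"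
  obtains t where "\<And>u. u \<in> removed r \<Longrightarrow> (\<Sum>i\<le>r. a i * u i) \<noteq> t"
    and "\<And>i. i \<le> r \<Longrightarrow> a i \<noteq> 0 \<Longrightarrow> \<exists>w. (\<Sum>i\<le>r. a i * w i) = t"
proof -
  obtain t where t: "\<And>x y. (x, y) \<in> uncovered \<Longrightarrow> a 0 * x + a 1 * y \<noteq> t"
    using uncovered_misses_level[of "a 0" "a 1"] by blast
  show ?thesis
  proof (rule that[of t])
    fix u :: "nat \<Rightarrow> 'a" assume u: "u \<in> removed r"
    have "{..r} = {0, 1} \<union> {2..r}" using assms by auto
    then have "(\<Sum>i\<le>r. a i * u i) = (\<Sum>i\<in>{0, 1}. a i * u i) + (\<Sum>i\<in>{2..r}. a i * u i)"
      by (simp only:) (rule sum.union_disjoint, auto)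
    also have "(\<Sum>i\<in>{2..r}. a i * u i) = 0"
      using u by (intro sum.neutral) (auto simp: removed_def)
    finally show "(\<Sum>i\<le>r. a i * u i) \<noteq> t" using t u by (simp add: removed_def)
  next
    fix i assume "i \<le> r" "a i \<noteq> 0"
    then show "\<exists>w. (\<Sum>i\<le>r. a i * w i) = t"
      by (intro exI[of _ "\<lambda>j. if j = i then t / a i else 0"]) (simp add: if_distrib cong: if_cong)
  qed
qed

text \<open>Padding with zeros embeds the plane in the block; \<open>1 \<le> r\<close> keeps index 1
  inside it.\<close>

lemma card_removed_ge:
  assumes "1 \<le> r"
  shows "card (uncovered :: ('a::{field,finite} \<times> 'a) set)
    \<le> card (({..r} \<rightarrow>\<^sub>E (UNIV :: 'a set)) \<inter> removed r)"
proof (rule card_inj_on_le)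
  let ?h = "\<lambda>(x, y). \<lambda>i\<in>{..r}. if i = 0 then x else if i = 1 then y else (0 :: 'a)"
  show "inj_on ?h uncovered"
  proof (rule inj_onI)
    fix p p' :: "'a \<times> 'a" assume eq: "?h p = ?h p'"
    show "p = p'"
      using fun_cong[OF eq, of 0] fun_cong[OF eq, of 1] assms by (simp split: prod.splits)
  qed
  show "?h ` uncovered \<subseteq> ({..r} \<rightarrow>\<^sub>E UNIV) \<inter> removed r"
    using assms by (auto simp: removed_def split: if_splits)
  show "finite (({..r} \<rightarrow>\<^sub>E (UNIV :: 'a set)) \<inter> removed r)"
    by (intro finite_Int disjI1 finite_PiE) auto
qed

text \<open>In each block a nonzero functional vanishes on \<open>L\<close>, since
  \<open>r < r + 1\<close>. Shifting by a point \<open>w\<close> of its missed level puts the whole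
  translate into that level. The blocks are disjoint, so the shifts combine into one vector.\<close>

lemma kakeya_set_blocks:
  fixes e :: "nat \<Rightarrow> nat \<Rightarrow> 'n::finite"
  assumes r: "1 \<le> r"
    and inj: "inj_on (\<lambda>(j, i). e j i) ({..<m} \<times> {..r})"
  shows "kakeya_set r {v :: 'a::{field,finite} ^ 'n. \<forall>j<m. (\<lambda>i. v $ e j i) \<notin> removed r}"
  unfolding kakeya_set_def
proof (intro allI impI)
  fix L :: "('a ^ 'n) set" assume L: "vec.subspace L \<and> vec.dim L = r"
  have "\<exists>w. \<forall>x\<in>L. (\<lambda>i. w i + x $ e j i) \<notin> removed r" for j
  proof -
    obtain a where a: "\<exists>i\<in>{..r}. a i \<noteq> 0" "\<And>x. x \<in> L \<Longrightarrow> (\<Sum>i\<le>r. a i * x $ e j i) = 0"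
      using exists_annihilating_functional[of L "{..r}" "e j"] L by auto
    obtain t where t: "\<And>u. u \<in> removed r \<Longrightarrow> (\<Sum>i\<le>r. a i * u i) \<noteq> t"
      "\<And>i. i \<le> r \<Longrightarrow> a i \<noteq> 0 \<Longrightarrow> \<exists>w. (\<Sum>i\<le>r. a i * w i) = t"
      using removed_misses_level[OF r] by blast
    then obtain w where "(\<Sum>i\<le>r. a i * w i) = t" using a(1) by auto
    then have "(\<Sum>i\<le>r. a i * (w i + x $ e j i)) = t" if "x \<in> L" for x
      using a(2)[OF that] by (simp add: distrib_left sum.distrib)
    then show ?thesis using t(1) by blast
  qed
  then obtain w where w: "\<And>j x. x \<in> L \<Longrightarrow> (\<lambda>i. w j i + x $ e j i) \<notin> removed r" by metis
  \<comment> \<open>\<open>?p\<close> recovers block and position from a coordinate. Outside the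
    blocks its value is unspecified, which is harmless as \<open>K\<close> puts no condition
    there.\<close>
  let ?p = "inv_into ({..<m} \<times> {..r}) (\<lambda>(j, i). e j i)"
  define v :: "'a ^ 'n" where "v = (\<chi> k. case ?p k of (j, i) \<Rightarrow> w j i)"
  have v: "v $ e j i = w j i" if "j < m" "i \<le> r" for i j
    using inv_into_f_f[OF inj, of "(j, i)"] that by (simp add: v_def)
  have "v + x \<in> {v. \<forall>j<m. (\<lambda>i. v $ e j i) \<notin> removed r}" if "x \<in> L" for x
    using w[OF that] r v by (simp add: removed_def)
  then show "\<exists>v. (+) v ` L \<subseteq> {v. \<forall>j<m. (\<lambda>i. v $ e j i) \<notin> removed r}" by blast
qed

section \<open>Counting the product set\<close>

text \<open>A vector is determined by its blocks and its remaining coordinates. By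
  \<open>restr\<close>, membership in \<open>B\<close> can be tested on the restricted blocks, which
  range over a finite set.\<close>

lemma card_blocks_le:
  fixes e :: "nat \<Rightarrow> nat \<Rightarrow> 'n::finite" and B :: "(nat \<Rightarrow> 'a::finite) set"
  assumes inj: "inj_on (\<lambda>(j, i). e j i) ({..<m} \<times> {..r})"
    and restr: "\<And>u. restrict u {..r} \<in> B \<longleftrightarrow> u \<in> B"
  shows "card {v :: 'a ^ 'n. \<forall>j<m. (\<lambda>i. v $ e j i) \<notin> B}
    \<le> card (({..r} \<rightarrow>\<^sub>E UNIV) - B) ^ m * CARD('a) ^ (CARD('n) - m * (r + 1))"
proof -
  let ?E = "(\<lambda>(j, i). e j i) ` ({..<m} \<times> {..r})"
  let ?K0 = "({..r} \<rightarrow>\<^sub>E UNIV) - B"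
  let ?T = "({..<m} \<rightarrow>\<^sub>E ?K0) \<times> (- ?E \<rightarrow>\<^sub>E (UNIV :: 'a set))"
  let ?h = "\<lambda>v :: 'a ^ 'n. (\<lambda>j\<in>{..<m}. \<lambda>i\<in>{..r}. v $ e j i, \<lambda>k\<in>- ?E. v $ k)"
  have "card {v :: 'a ^ 'n. \<forall>j<m. (\<lambda>i. v $ e j i) \<notin> B} \<le> card ?T"
  proof (rule card_inj_on_le[of ?h])
    show "inj_on ?h {v. \<forall>j<m. (\<lambda>i. v $ e j i) \<notin> B}"
    proof (rule inj_onI)
      fix v v' :: "'a ^ 'n" assume eq: "?h v = ?h v'"
      have "v $ k = v' $ k" for k
      proof (cases "k \<in> ?E")
        case True
        then obtain i j where "j < m" "i \<le> r" "k = e j i" by auto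
        then show ?thesis
          using fun_cong[OF fun_cong[OF arg_cong[OF eq, of fst], of j], of i] by simp
      next
        case False
        then show ?thesis using fun_cong[OF arg_cong[OF eq, of snd], of k] by simp
      qed
      then show "v = v'" by (simp add: vec_eq_iff)
    qed
    show "?h ` {v. \<forall>j<m. (\<lambda>i. v $ e j i) \<notin> B} \<subseteq> ?T"
      by (auto simp: restr split: if_splits)
    show "finite ?T"
      by (intro finite_cartesian_product finite_PiE finite_Diff) auto
  qed
  also have "card ?T = card ?K0 ^ m * CARD('a) ^ card (- ?E)"
    by (simp add: card_cartesian_product card_funcsetE)
  also have "card (- ?E) = CARD('n) - m * (r + 1)"
    using card_image[OF inj] by (simp add: Compl_eq_Diff_UNIV card_Diff_subset)
  finally show ?thesis .
qed

theorem theorem2: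
  fixes n r q :: nat
  assumes "n = CARD('n::finite)" and "q = CARD('a::{field,finite})"
    and "1 \<le> r" and "r \<le> n"
  shows "\<exists>K :: ('a ^ 'n) set. kakeya_set r K \<and>
    real (card K) \<le> (1 - (real q - kakeya_delta q) / (2 * real q ^ r)) ^ (n div (r + 1)) * real q ^ n"
proof -
  define m where "m = n div (r + 1)"
  have mn: "m * (r + 1) \<le> n" unfolding m_def by (rule div_times_less_eq_dividend)
  obtain b where b: "bij_betw b {0..<n} (UNIV :: 'n set)"
    using ex_bij_betw_nat_finite[of "UNIV :: 'n set"] assms(1) by auto
  \<comment> \<open>Consecutive runs of \<open>r + 1\<close> indices, carried to the coordinate type
    by the enumeration \<open>b\<close>; \<open>m\<close> of them fit by \<open>mn\<close>.\<close>
  define e where "e j i = b (j * (r + 1) + i)" for j i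
  have inj: "inj_on (\<lambda>(j, i). e j i) ({..<m} \<times> {..r})"
  proof (rule inj_onI)
    fix p p' assume dom: "p \<in> {..<m} \<times> {..r}" "p' \<in> {..<m} \<times> {..r}"
      and eq: "(\<lambda>(j, i). e j i) p = (\<lambda>(j, i). e j i) p'"
    obtain j i j' i' where p: "p = (j, i)" "p' = (j', i')" by (metis surj_pair)
    then have lt: "j < m" "i \<le> r" "j' < m" "i' \<le> r" using dom by auto
    have "j * (r + 1) + i < n" if "j < m" "i \<le> r" for i j
    proof -
      have "j * (r + 1) + i < (j + 1) * (r + 1)" using that by simp
      also have "\<dots> \<le> m * (r + 1)" using that by (intro mult_le_mono1) simp
      finally show ?thesis using mn by linarith
    qed
    with b eq lt p have *: "j * (r + 1) + i = j' * (r + 1) + i'"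
      unfolding e_def bij_betw_def inj_on_def by auto
    have "(j * (r + 1) + i) div (r + 1) = j" "(j' * (r + 1) + i') div (r + 1) = j'"
      using lt by (simp_all del: mult_Suc_right)
    with * p show "p = p'" by auto
  qed
  let ?K = "{v :: 'a ^ 'n. \<forall>j<m. (\<lambda>i. v $ e j i) \<notin> removed r}"
  let ?F = "{..r} \<rightarrow>\<^sub>E (UNIV :: 'a set)"
  let ?c = "1 - (real q - kakeya_delta q) / (2 * real q ^ r)"
  have q: "q > 0" using assms(2) by simp
  have fin: "finite ?F" by (intro finite_PiE) auto
  have "card (?F - removed r) + card (?F \<inter> removed r) = q ^ (r + 1)"
    using card_Diff_subset_Int[of ?F "removed r"] card_mono[OF fin, of "?F \<inter> removed r"] fin assms(2)
    by (simp add: card_funcsetE)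
  then have "real (card (?F - removed r)) + real (card (?F \<inter> removed r)) = real q ^ (r + 1)"
    by (metis of_nat_add of_nat_power)
  moreover have "real q * (real q - kakeya_delta q) / 2 \<le> real (card (?F \<inter> removed r))"
    using card_uncovered_ge_real[OF assms(2)] card_removed_ge[OF assms(3), where 'a = 'a]
    by linarith
  \<comment> \<open>Removing \<open>q * (q - delta) / 2\<close> of the \<open>q ^ (r + 1)\<close>
    block vectors leaves the fraction \<open>?c\<close>.\<close>
  moreover have "?c * real q ^ (r + 1) = real q ^ (r + 1) - real q * (real q - kakeya_delta q) / 2"
    using q by (simp add: field_simps)
  ultimately have block: "real (card (?F - removed r)) \<le> ?c * real q ^ (r + 1)" by linarith
  have "card ?K \<le> card (?F - removed r) ^ m * q ^ (n - m * (r + 1))"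
    unfolding assms(1,2) using assms(3) by (intro card_blocks_le inj) (auto simp: removed_def)
  from of_nat_mono[OF this, where 'a = real]
  have "real (card ?K) \<le> real (card (?F - removed r)) ^ m * real q ^ (n - m * (r + 1))"
    by simp
  also have "\<dots> \<le> (?c * real q ^ (r + 1)) ^ m * real q ^ (n - m * (r + 1))"
    using block by (intro mult_right_mono power_mono) auto
  also have "\<dots> = ?c ^ m * (real q ^ (m * (r + 1)) * real q ^ (n - m * (r + 1)))"
    by (simp only: power_mult_distrib power_mult[symmetric] mult.commute[of m] mult.assoc)
  \<comment> \<open>By \<open>mn\<close> the natural-number subtraction in the exponent is not
    truncated.\<close>
  also have "\<dots> = ?c ^ m * real q ^ n"
    using mn by (simp only: power_add[symmetric] le_add_diff_inverse)
  finally show ?thesis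
    using kakeya_set_blocks[OF assms(3) inj] unfolding m_def by blast
qed

end
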